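(* Let $\beta\ge2$, $p=\frac{\beta-1}{\beta}$, $\gamma>0$, $Q:=BN$, and let positive constants $d,L,R,\kappa,\kappa_\beta,\sigma_*$ be given. Consider the error bound $$\mathcal{E}(N,B,\delta)=\frac{LR^2}{N^2}+\frac{LR^2}{Q}+\frac{R}{\sqrt Q}\left(\sqrt{d\kappa\sigma_*}+\sqrt{d\kappa Lh}+\sqrt{\kappa\frac{d\delta}{h}}\right)+R\left(\kappa_\beta Lh^{\beta-1}+\frac{d\delta}{h}\right)+N\left(\kappa_\beta^2Lh^{2(\beta-1)}+\frac{d^2\delta^2}{Lh^2}\right)$$ with smoothing radius $h=h^*(\delta):=\left(\frac{d\delta}{\kappa_\beta L}\right)^{1/\beta}$, and the wall-clock time $T_{\mathrm{total}}=Q\,\delta^{-\gamma}$, to be minimized over $(N,B,\delta)$ subject to $\mathcal{E}(N,B,\delta)\le\varepsilon$. Put $a_1:=(\kappa_\beta L)^{1/\beta}d^{(\beta-1)/\beta}$ and $a_2:=\kappa_\beta^{2/\beta}L^{2/\beta-1}d^{2(\beta-1)/\beta}$, so that the last two terms of $\mathcal{E}$ are of order $Ra_1\delta^p$ and $Na_2\delta^{2p}$. In the large-$N$, large-$Q$ regime (that is, as $\varepsilon\to0$, with $N\gtrsim R^2a_1^2/(a_2\varepsilon)$ so that the channel $Na_2\delta^{2p}$ is active, and the term $R\sqrt{d\kappa\sigma_*}/\sqrt Q$ dominating $LR^2/Q$), the optimal design satisfies $$N^*\asymp\frac{LR^2}{\varepsilon},\qquad Q^*\asymp\frac{R^2\kappa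 d\sigma_*}{\varepsilon^2},\qquad B^*=\frac{Q^*}{N^*}\asymp\frac{\kappa d\sigma_*}{L\varepsilon},$$ $$\delta^*\asymp\frac{\varepsilon^{\frac{\beta}{\beta-1}}}{d\,\kappa_\beta^{\frac1{\beta-1}}L^{\frac1{\beta-1}}R^{\frac\beta{\beta-1}}},\qquad h^*=h^*(\delta^* ),$$ and consequently $$T^*_{\mathrm{total}}\asymp\frac{\kappa\,\sigma_*\,d^{1+\gamma}\,\kappa_\beta^{\frac\gamma{\beta-1}}L^{\frac\gamma{\beta-1}}R^{2+\frac{\gamma\beta}{\beta-1}}}{\varepsilon^{2+\frac{\gamma\beta}{\beta-1}}}.$$
   Context: Origin of the bound: $f(x)=\mathbb{E}_\zeta f(x,\zeta)$ on $\mathbb{R}^d$ is minimized by batched accelerated zeroth-order SGD with $N$ iterations, batch size $B$, and a two-point kernel gradient estimator with smoothing radius $h$; the oracle output is $f(x,\zeta)+\xi(x)$ with deterministic adversarial noise $|\xi(x)|\le\delta$, at cost $c(\delta)=\delta^{-\gamma}$; $\mathcal{E}$ bounds $\mathbb{E}f(x_N)-f^*$ up to constants. $\beta$ is the Hölder smoothness order, $L$ the smoothness constant, $R$ the initial distance to the minimizer $x^*$, $\sigma_*>0$ the noise parameter with $\mathbb{E}_\zeta\|\nabla f(x^*,\zeta)-\nabla f(x^* )\|^2\le\sigma_*^2$, and, for the smoothing kernel $K$, $\kappa_\beta=\int|u|^\beta|K(u)|du$, $\kappa=\int|K(u)|^2du$. $\asymp$ and $\gtrsim$ hide positive constants depending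 only on $\beta$ and $\gamma$. *)

theory Defs
  imports Complex_Main
begin

text \<open>
  Parameter order throughout: smoothness order \<open>\<beta>\<close>, dimension \<open>d\<close>, smoothness constant \<open>L\<close>,
  initial distance \<open>R\<close>, kernel constants \<open>\<kappa>\<close> and \<open>\<kappa>\<^sub>\<beta>\<close> (written \<open>\<kappa>b\<close>), noise parameter \<open>\<sigma>\<close>.
  A design consists of the number of iterations \<open>N\<close>, the batch size \<open>B\<close> and the
  adversarial noise level \<open>\<delta>\<close>.
\<close>

definition h_star :: "real \<Rightarrow> real \<Rightarrow> real \<Rightarrow> real \<Rightarrow> real \<Rightarrow> real" where
  "h_star \<beta> d L \<kappa>b \<delta> = (d * \<delta> / (\<kappa>b * L)) powr (1 / \<beta>)"

definition error_bound ::
  "real \<Rightarrow> real \<Rightarrow> real \<Rightarrow> real \<Rightarrow> real \<Rightarrow> real \<Rightarrow> real \<Rightarrow> nat \<Rightarrow> nat \<Rightarrow> real \<Rightarrow> real" where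
  "error_bound \<beta> d L R \<kappa> \<kappa>b \<sigma> N B \<delta> =
    (let Q = real B * real N; h = h_star \<beta> d L \<kappa>b \<delta> in
       L * R\<^sup>2 / (real N)\<^sup>2 + L * R\<^sup>2 / Q
       + R / sqrt Q * (sqrt (d * \<kappa> * \<sigma>) + sqrt (d * \<kappa> * L * h) + sqrt (\<kappa> * (d * \<delta> / h)))
       + R * (\<kappa>b * L * h powr (\<beta> - 1) + d * \<delta> / h)
       + real N * (\<kappa>b\<^sup>2 * L * h powr (2 * (\<beta> - 1)) + d\<^sup>2 * \<delta>\<^sup>2 / (L * h\<^sup>2)))"

definition a1 :: "real \<Rightarrow> real \<Rightarrow> real \<Rightarrow> real \<Rightarrow> real" where
  "a1 \<beta> d L \<kappa>b = (\<kappa>b * L) powr (1 / \<beta>) * d powr ((\<beta> - 1) / \<beta>)"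

definition a2 :: "real \<Rightarrow> real \<Rightarrow> real \<Rightarrow> real \<Rightarrow> real" where
  "a2 \<beta> d L \<kappa>b = \<kappa>b powr (2 / \<beta>) * L powr (2 / \<beta> - 1) * d powr (2 * (\<beta> - 1) / \<beta>)"

definition T_total :: "real \<Rightarrow> nat \<Rightarrow> nat \<Rightarrow> real \<Rightarrow> real" where
  "T_total \<gamma> N B \<delta> = real B * real N * \<delta> powr (- \<gamma>)"

text \<open>
  The last two conditions delimit the large-\<open>N\<close>, large-\<open>Q\<close> regime; \<open>c0\<close> is the constant hidden
  in \<open>N \<gtrsim> R\<^sup>2 a\<^sub>1\<^sup>2 / (a\<^sub>2 \<epsilon>)\<close>. The lower bound on \<open>N\<close> is a genuine constraint of the
  optimization: without it the minimizers have \<open>N\<close> of the smaller order \<open>(L R\<^sup>2 / \<epsilon>) powr (2/3)\<close>.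
  Positivity of \<open>N\<close> and \<open>B\<close> excludes the convention \<open>x / 0 = 0\<close>.
\<close>

definition feasible_design ::
  "real \<Rightarrow> real \<Rightarrow> real \<Rightarrow> real \<Rightarrow> real \<Rightarrow> real \<Rightarrow> real \<Rightarrow> real \<Rightarrow> real \<Rightarrow> nat \<Rightarrow> nat \<Rightarrow> real \<Rightarrow> bool" where
  "feasible_design \<beta> d L R \<kappa> \<kappa>b \<sigma> c0 \<epsilon> N B \<delta> \<longleftrightarrow>
     N > 0 \<and> B > 0 \<and> \<delta> > 0 \<and>
     error_bound \<beta> d L R \<kappa> \<kappa>b \<sigma> N B \<delta> \<le> \<epsilon> \<and>
     real N \<ge> c0 * (R\<^sup>2 * (a1 \<beta> d L \<kappa>b)\<^sup>2 / (a2 \<beta> d L \<kappa>b * \<epsilon>)) \<and>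
     L * R\<^sup>2 / (real B * real N) \<le> R * sqrt (d * \<kappa> * \<sigma>) / sqrt (real B * real N)"

definition optimal_design ::
  "real \<Rightarrow> real \<Rightarrow> real \<Rightarrow> real \<Rightarrow> real \<Rightarrow> real \<Rightarrow> real \<Rightarrow> real \<Rightarrow> real \<Rightarrow> real \<Rightarrow> nat \<Rightarrow> nat \<Rightarrow> real \<Rightarrow> bool" where
  "optimal_design \<beta> \<gamma> d L R \<kappa> \<kappa>b \<sigma> c0 \<epsilon> N B \<delta> \<longleftrightarrow>
     feasible_design \<beta> d L R \<kappa> \<kappa>b \<sigma> c0 \<epsilon> N B \<delta> \<and>
     (\<forall>N' B' \<delta>'. feasible_design \<beta> d L R \<kappa> \<kappa>b \<sigma> c0 \<epsilon> N' B' \<delta>' \<longrightarrow>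
        T_total \<gamma> N B \<delta> \<le> T_total \<gamma> N' B' \<delta>')"

text \<open>
  The relation \<open>x \<asymp> y\<close> with its hidden constants explicit, so that their uniformity in the
  problem parameters can be stated; this is why \<open>\<Theta>\<close> is not used.
\<close>

definition same_order :: "real \<Rightarrow> real \<Rightarrow> real \<Rightarrow> real \<Rightarrow> bool" where
  "same_order c C x y \<longleftrightarrow> c * y \<le> x \<and> x \<le> C * y"

end

theory Submission
  imports Defs
begin

text \<open>
  The radius \<open>h\<^sup>*(\<delta>)\<close> balances the smoothing bias \<open>\<kappa>\<^sub>\<beta> L h\<^sup>\<beta>\<^sup>-\<^sup>1\<close> against the bias \<open>d \<delta> / h\<close> of
  the adversarial noise. Both then equal one quantity \<open>b(\<delta>) = a\<^sub>1 \<delta>\<^sup>p\<close>, increasing in \<open>\<delta>\<close>, and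
  \<open>a\<^sub>2 = a\<^sub>1\<^sup>2 / L\<close>, so the last two terms of the error bound are \<open>2 R b\<close> and \<open>2 N b\<^sup>2 / L\<close>, while
  the lower bound imposed on \<open>N\<close> reads \<open>N \<ge> c0 L R\<^sup>2 / \<epsilon>\<close>. The claimed noise level \<open>\<delta>\<^sup>*\<close> is
  exactly the solution of \<open>b(\<delta>) = \<epsilon> / R\<close>.

  Every term of the error bound is nonnegative, so each one alone is at most \<open>\<epsilon>\<close> in a feasible
  design. The term with \<open>\<sigma>\<^sub>*\<close> gives \<open>Q \<ge> Q\<^sup>*\<close> and the term \<open>2 R b\<close> gives \<open>\<delta> \<le> \<delta>\<^sup>*\<close>; together
  they bound the time below by \<open>T\<^sup>* = Q\<^sup>* (\<delta>\<^sup>*)\<^bsup>-\<gamma>\<^esup>\<close> (lemma \<open>feasible_bounds\<close>).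
  Conversely, for small \<open>\<epsilon>\<close> an explicit design with \<open>N\<close>, \<open>Q\<close>, \<open>\<delta>\<close> of the claimed orders is
  feasible (lemma \<open>feasible_design_exists\<close>): its constants divide \<open>\<epsilon>\<close> among the term with
  \<open>\<sigma>\<^sub>*\<close> and the two bias terms, and all other terms are of lower order. Hence the minimal
  time is at most \<open>K T\<^sup>*\<close> with \<open>K\<close> depending only on \<open>\<beta>\<close>, \<open>\<gamma>\<close> and \<open>c0\<close>.

  The individual orders follow because the bounds on \<open>Q\<close> and on \<open>\<delta>\<close> are both nearly tight
  (lemma \<open>near_optimal_design_orders\<close>): from \<open>Q \<ge> Q\<^sup>*\<close> and
  \<open>Q \<delta>\<^bsup>-\<gamma>\<^esup> \<le> K T\<^sup>*\<close> one gets \<open>\<delta> \<ge> k \<delta>\<^sup>*\<close> with \<open>k = K\<^bsup>-1/\<gamma>\<^esup>\<close>, and from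
  \<open>\<delta> \<le> \<delta>\<^sup>*\<close> one gets \<open>Q \<le> K Q\<^sup>*\<close>. The cost does not depend on \<open>N\<close> for given \<open>Q\<close>; what caps \<open>N\<close>
  is the term \<open>2 N b\<^sup>2 / L \<le> \<epsilon>\<close>, in which \<open>b \<ge> k\<^sup>p \<epsilon> / R\<close>.

  That the minimum is attained is a separate matter (lemma \<open>optimal_design_exists\<close>): bounded cost
  leaves finitely many pairs \<open>(N, B)\<close>, and for each of them the feasible \<open>\<delta>\<close> have a largest
  element by compactness.
\<close>

section \<open>Bias at the balancing radius\<close>

locale zeroth_order_sgd =
  fixes \<beta> d L R \<kappa> \<kappa>b \<sigma> :: real
  assumes \<beta>: "\<beta> \<ge> 2" and d: "d > 0" and L: "L > 0" and R: "R > 0"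
    and \<kappa>: "\<kappa> > 0" and \<kappa>b: "\<kappa>b > 0" and \<sigma>: "\<sigma> > 0"
begin

abbreviation "h \<equiv> h_star \<beta> d L \<kappa>b"
abbreviation "p \<equiv> (\<beta> - 1) / \<beta>"
abbreviation "A1 \<equiv> a1 \<beta> d L \<kappa>b"
abbreviation "A2 \<equiv> a2 \<beta> d L \<kappa>b"
abbreviation "err \<equiv> error_bound \<beta> d L R \<kappa> \<kappa>b \<sigma>"
abbreviation "feasible \<equiv> feasible_design \<beta> d L R \<kappa> \<kappa>b \<sigma>"
abbreviation "optimal \<gamma> \<equiv> optimal_design \<beta> \<gamma> d L R \<kappa> \<kappa>b \<sigma>"

text \<open>The common value of the two biases that the radius \<open>h \<delta>\<close> balances.\<close>

definition bias :: "real \<Rightarrow> real" where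
  "bias \<delta> = d * \<delta> / h \<delta>"

definition \<delta>_opt :: "real \<Rightarrow> real" where
  "\<delta>_opt \<epsilon> = \<epsilon> powr (\<beta> / (\<beta> - 1)) /
     (d * \<kappa>b powr (1 / (\<beta> - 1)) * L powr (1 / (\<beta> - 1)) * R powr (\<beta> / (\<beta> - 1)))"

definition Q_opt :: "real \<Rightarrow> real" where
  "Q_opt \<epsilon> = R\<^sup>2 * \<kappa> * d * \<sigma> / \<epsilon>\<^sup>2"

lemma p_pos: "p > 0"
  using \<beta> by simp

lemma h_pos: "\<delta> > 0 \<Longrightarrow> h \<delta> > 0"
  using d L \<kappa>b by (simp add: h_star_def)

lemma bias_pos: "\<delta> > 0 \<Longrightarrow> bias \<delta> > 0"
  using d h_pos by (simp add: bias_def)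

lemma A1_pos: "A1 > 0"
  using d L \<kappa>b by (simp add: a1_def)

text \<open>
  The radius is chosen so that \<open>\<kappa>\<^sub>\<beta> L h\<^sup>\<beta> = d \<delta>\<close>; dividing by \<open>h\<close> gives the balance.
\<close>

lemma smoothing_bias_eq:
  assumes "\<delta> > 0"
  shows "\<kappa>b * L * h \<delta> powr (\<beta> - 1) = bias \<delta>"
proof -
  have "h \<delta> powr \<beta> = d * \<delta> / (\<kappa>b * L)"
    using assms \<beta> d L \<kappa>b by (simp add: h_star_def powr_powr)
  then show ?thesis
    using h_pos[OF assms] L \<kappa>b by (simp add: bias_def powr_diff)
qed

lemma bias_eq:
  assumes "\<delta> > 0"
  shows "bias \<delta> = A1 * \<delta> powr p"
proof -
  have p: "p = 1 - 1 / \<beta>" using \<beta> by (simp add: field_simps)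
  have "bias \<delta> = (d * \<delta>) powr 1 / (d * \<delta>) powr (1 / \<beta>) * (\<kappa>b * L) powr (1 / \<beta>)"
    using assms d L \<kappa>b by (simp add: bias_def h_star_def powr_divide)
  also have "\<dots> = (d * \<delta>) powr p * (\<kappa>b * L) powr (1 / \<beta>)"
    unfolding p using assms d by (subst powr_diff) simp
  also have "\<dots> = A1 * \<delta> powr p"
    using assms d by (simp add: a1_def powr_mult)
  finally show ?thesis .
qed

text \<open>
  This makes \<open>a\<^sub>2 \<delta>\<^sup>2\<^sup>p = (bias \<delta>)\<^sup>2 / L\<close>, and it collapses the bound \<open>R\<^sup>2 a\<^sub>1\<^sup>2 / (a\<^sub>2 \<epsilon>)\<close>
  on \<open>N\<close> to \<open>L R\<^sup>2 / \<epsilon>\<close>.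
\<close>

lemma A2_eq: "A2 = A1\<^sup>2 / L"
proof -
  have sq: "(x powr a)\<^sup>2 = x powr (2 * a)" if "x > 0" for x a :: real
    using that by (simp add: power2_eq_square powr_add[symmetric])
  have "A1\<^sup>2 = (\<kappa>b * L) powr (2 / \<beta>) * d powr (2 * p)"
    using d L \<kappa>b by (simp add: a1_def power_mult_distrib sq)
  then show ?thesis
    using d L \<kappa>b by (simp add: a2_def powr_mult powr_diff)
qed

lemma bias_terms_eq:
  assumes "\<delta> > 0"
  shows "R * (\<kappa>b * L * h \<delta> powr (\<beta> - 1) + d * \<delta> / h \<delta>) = 2 * R * bias \<delta>"
  using smoothing_bias_eq[OF assms] by (simp add: bias_def)

lemma squared_bias_terms_eq:
  assumes "\<delta> > 0"
  shows "n * (\<kappa>b\<^sup>2 * L * h \<delta> powr (2 * (\<beta> - 1)) + d\<^sup>2 * \<delta>\<^sup>2 / (L * (h \<delta>)\<^sup>2))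
    = 2 * n * (bias \<delta>)\<^sup>2 / L"
proof -
  have "h \<delta> powr (2 * (\<beta> - 1)) = (h \<delta> powr (\<beta> - 1))\<^sup>2"
    using h_pos[OF assms] by (simp add: power2_eq_square powr_add[symmetric])
  then have "\<kappa>b\<^sup>2 * L * h \<delta> powr (2 * (\<beta> - 1)) = (bias \<delta>)\<^sup>2 / L"
    using L by (simp add: smoothing_bias_eq[OF assms, symmetric] power2_eq_square)
  moreover have "d\<^sup>2 * \<delta>\<^sup>2 / (L * (h \<delta>)\<^sup>2) = (bias \<delta>)\<^sup>2 / L"
    by (simp add: bias_def power_divide power_mult_distrib)
  ultimately show ?thesis by (simp add: distrib_left)
qed

lemma error_bound_eq:
  assumes "\<delta> > 0"
  shows "err N B \<delta> = L * R\<^sup>2 / (real N)\<^sup>2 + L * R\<^sup>2 / (real B * real N)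
    + R / sqrt (real B * real N)
      * (sqrt (d * \<kappa> * \<sigma>) + sqrt (d * \<kappa> * L * h \<delta>) + sqrt (\<kappa> * bias \<delta>))
    + 2 * R * bias \<delta> + 2 * real N * (bias \<delta>)\<^sup>2 / L"
  using bias_terms_eq[OF assms] squared_bias_terms_eq[OF assms, of "real N"]
  by (simp add: error_bound_def Let_def bias_def)

lemma bias_le_iff:
  assumes "\<delta> > 0" "\<delta>' > 0"
  shows "bias \<delta> \<le> bias \<delta>' \<longleftrightarrow> \<delta> \<le> \<delta>'"
proof -
  have "bias \<delta> \<le> bias \<delta>' \<longleftrightarrow> \<delta> powr p \<le> \<delta>' powr p"
    using assms A1_pos by (simp add: bias_eq)
  also have "\<dots> \<longleftrightarrow> \<delta> \<le> \<delta>'"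
    using assms p_pos by (meson powr_less_mono2 powr_mono2 less_imp_le linorder_not_le)
  finally show ?thesis .
qed

section \<open>Lower bounds for feasible designs\<close>

lemma \<delta>_opt_pos: "\<epsilon> > 0 \<Longrightarrow> \<delta>_opt \<epsilon> > 0"
  using d L R \<kappa>b by (simp add: \<delta>_opt_def)

lemma Q_opt_pos: "\<epsilon> > 0 \<Longrightarrow> Q_opt \<epsilon> > 0"
  using d R \<kappa> \<sigma> by (simp add: Q_opt_def)

text \<open>
  The claimed noise level is the one with bias \<open>\<epsilon> / R\<close>. The factor \<open>s\<close> transfers bounds relative
  to \<open>\<delta>_opt \<epsilon>\<close> into bounds on the bias and back.
\<close>

lemma bias_scaled_\<delta>_opt:
  assumes "\<epsilon> > 0" "s > 0"
  shows "bias (s * \<delta>_opt \<epsilon>) = s powr p * \<epsilon> / R"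
proof -
  have e: "\<beta> / (\<beta> - 1) * p = 1" "1 / (\<beta> - 1) * p = 1 / \<beta>"
    using \<beta> by (simp_all add: field_simps)
  have "\<delta>_opt \<epsilon> powr p
      = \<epsilon> / (d powr p * \<kappa>b powr (1 / \<beta>) * L powr (1 / \<beta>) * R)"
    unfolding \<delta>_opt_def using assms d L R \<kappa>b
    by (simp add: powr_divide powr_mult powr_powr e del: times_divide_eq_left times_divide_eq_right)
  then show ?thesis
    using assms \<delta>_opt_pos[of \<epsilon>] d L R \<kappa>b by (simp add: bias_eq a1_def powr_mult)
qed

lemma bias_\<delta>_opt: "\<epsilon> > 0 \<Longrightarrow> bias (\<delta>_opt \<epsilon>) = \<epsilon> / R"
  using bias_scaled_\<delta>_opt[of \<epsilon> 1] by simp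

text \<open>
  The terms of the error bound are nonnegative, so each of them is at most \<open>\<epsilon>\<close>. The variance
  term at the minimizer bounds \<open>Q\<close> from below, and the bias term bounds \<open>\<delta>\<close> from above.
\<close>

lemma feasible_bounds:
  assumes \<epsilon>: "\<epsilon> > 0" and feas: "feasible c0 \<epsilon> N B \<delta>"
  shows "N > 0" "B > 0" "\<delta> > 0"
    and "Q_opt \<epsilon> \<le> real B * real N"
    and "\<delta> \<le> \<delta>_opt \<epsilon>"
    and "2 * real N * (bias \<delta>)\<^sup>2 / L \<le> \<epsilon>"
    and "c0 * (L * R\<^sup>2 / \<epsilon>) \<le> real N"
proof -
  show N: "N > 0" and B: "B > 0" and \<delta>: "\<delta> > 0"
    using feas by (auto simp: feasible_design_def)
  let ?Q = "real B * real N"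
  have Q: "?Q > 0" using N B by simp
  have nonneg: "L * R\<^sup>2 / (real N)\<^sup>2 \<ge> 0" "L * R\<^sup>2 / ?Q \<ge> 0"
      "R / sqrt ?Q * sqrt (d * \<kappa> * \<sigma>) \<ge> 0" "R / sqrt ?Q * sqrt (d * \<kappa> * L * h \<delta>) \<ge> 0"
      "R / sqrt ?Q * sqrt (\<kappa> * bias \<delta>) \<ge> 0" "2 * R * bias \<delta> \<ge> 0"
      "2 * real N * (bias \<delta>)\<^sup>2 / L \<ge> 0"
    using L R d \<kappa> \<sigma> Q h_pos[OF \<delta>] bias_pos[OF \<delta>] by simp_all
  have "err N B \<delta> \<le> \<epsilon>" using feas by (simp add: feasible_design_def)
  then have "L * R\<^sup>2 / (real N)\<^sup>2 + L * R\<^sup>2 / ?Q + (R / sqrt ?Q * sqrt (d * \<kappa> * \<sigma>)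
      + R / sqrt ?Q * sqrt (d * \<kappa> * L * h \<delta>) + R / sqrt ?Q * sqrt (\<kappa> * bias \<delta>))
      + 2 * R * bias \<delta> + 2 * real N * (bias \<delta>)\<^sup>2 / L \<le> \<epsilon>"
    by (simp only: error_bound_eq[OF \<delta>] distrib_left)
  then have noise: "R / sqrt ?Q * sqrt (d * \<kappa> * \<sigma>) \<le> \<epsilon>"
      and b: "2 * R * bias \<delta> \<le> \<epsilon>"
      and sb: "2 * real N * (bias \<delta>)\<^sup>2 / L \<le> \<epsilon>"
    using nonneg by linarith+
  show "2 * real N * (bias \<delta>)\<^sup>2 / L \<le> \<epsilon>" by (fact sb)
  have "(R / sqrt ?Q * sqrt (d * \<kappa> * \<sigma>))\<^sup>2 \<le> \<epsilon>\<^sup>2"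
    using noise nonneg(3) by (rule power_mono)
  then have "R\<^sup>2 / ?Q * (d * \<kappa> * \<sigma>) \<le> \<epsilon>\<^sup>2"
    using Q d \<kappa> \<sigma> by (simp add: power_mult_distrib power_divide real_sqrt_pow2)
  then show "Q_opt \<epsilon> \<le> ?Q"
    using Q \<epsilon> by (simp add: Q_opt_def field_simps)
  \<comment> \<open>The bias term even gives \<open>bias \<delta> \<le> \<epsilon> / (2 R)\<close>; the factor 2 is given away so that the bound
      is \<open>\<delta>_opt\<close> itself.\<close>
  have "bias \<delta> \<le> \<epsilon> / R"
  proof -
    have "R * bias \<delta> > 0" using R bias_pos[OF \<delta>] by simp
    then have "R * bias \<delta> \<le> \<epsilon>" using b by linarith
    then show ?thesis using R by (simp add: field_simps)
  qed
  then show "\<delta> \<le> \<delta>_opt \<epsilon>"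
    using bias_le_iff[OF \<delta> \<delta>_opt_pos[OF \<epsilon>]] bias_\<delta>_opt[OF \<epsilon>] by simp
  have "R\<^sup>2 * A1\<^sup>2 / (A2 * \<epsilon>) = L * R\<^sup>2 / \<epsilon>"
    using A1_pos L by (simp add: A2_eq)
  then show "c0 * (L * R\<^sup>2 / \<epsilon>) \<le> real N"
    using feas by (simp add: feasible_design_def)
qed

section \<open>A feasible design of the claimed order\<close>

text \<open>
  The witness has \<open>N \<approx> c1 L R\<^sup>2 / \<epsilon>\<close>, \<open>Q \<approx> 256 Q\<^sup>*\<close> and bias \<open>\<epsilon> / (16 c1 R)\<close>. The number 256 makes the
  variance term at most \<open>\<epsilon> / 16\<close>, and with it three further terms that are smaller for small
  \<open>\<epsilon>\<close>. The divisor \<open>16 c1\<close> pays for the two bias terms, of which the one with \<open>N\<close> grows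
  linearly in \<open>c1\<close> and quadratically in the bias. Only the smallness assumptions on \<open>\<epsilon>\<close>
  involve the remaining parameters.
\<close>

lemma feasible_design_exists:
  assumes c1: "c1 \<ge> 1" "c0 \<le> c1" and \<epsilon>: "\<epsilon> > 0"
    and small_N: "\<epsilon> \<le> L * R\<^sup>2 / 8"
    and small_Q: "2 * c1 * (L * R\<^sup>2) * \<epsilon> \<le> 256 * (R\<^sup>2 * \<kappa> * d * \<sigma>)"
    and small_regime: "\<epsilon> \<le> 16 * (d * \<kappa> * \<sigma>) / L"
    and small_bias: "\<epsilon> \<le> d * \<sigma> * R"
    and small_h: "\<epsilon> \<le> R * (\<kappa>b * L * (\<sigma> / L) powr (\<beta> - 1))"
  shows "\<exists>N B. feasible c0 \<epsilon> N B ((1 / (16 * c1)) powr (1 / p) * \<delta>_opt \<epsilon>)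
           \<and> real B * real N \<le> 512 * Q_opt \<epsilon>"
proof -
  define N0 where "N0 = c1 * (L * R\<^sup>2 / \<epsilon>)"
  define N where "N = nat \<lceil>N0\<rceil>"
  define B where "B = nat \<lceil>256 * Q_opt \<epsilon> / real N\<rceil>"
  define \<delta> where "\<delta> = (1 / (16 * c1)) powr (1 / p) * \<delta>_opt \<epsilon>"
  let ?Q = "real B * real N"
  have LR: "L * R\<^sup>2 > 0" using L R by simp
  have "1 \<le> L * R\<^sup>2 / \<epsilon>" using small_N \<epsilon> LR by (simp add: field_simps)
  moreover have "L * R\<^sup>2 / \<epsilon> \<le> N0"
    using c1(1) LR \<epsilon> mult_right_mono[of 1 c1 "L * R\<^sup>2 / \<epsilon>"] by (simp add: N0_def)
  ultimately have N0: "1 \<le> N0" "L * R\<^sup>2 / \<epsilon> \<le> N0" by simp_all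
  have N: "N0 \<le> real N" "real N \<le> 2 * N0" "real N > 0"
    using N0(1) unfolding N_def by linarith+
  have B_lower: "256 * Q_opt \<epsilon> / real N \<le> real B"
    and B_upper: "real B \<le> 256 * Q_opt \<epsilon> / real N + 1"
    using Q_opt_pos[OF \<epsilon>] N(3) unfolding B_def
    by (simp_all add: real_nat_ceiling_ge)
  have Bpos: "real B > 0"
    using B_lower Q_opt_pos[OF \<epsilon>] N(3) by (smt (verit) divide_pos_pos)
  have Q_lower: "256 * Q_opt \<epsilon> \<le> ?Q"
    using B_lower N(3) by (simp add: field_simps)
  have "?Q \<le> 256 * Q_opt \<epsilon> + real N"
    using mult_right_mono[OF B_upper, of "real N"] N(3)
    by (simp add: distrib_right)
  \<comment> \<open>Rounding \<open>B\<close> up costs at most \<open>N\<close> oracle calls, negligible because \<open>N\<close> grows like \<open>1 / \<epsilon>\<close>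
      and \<open>Q\<close> like \<open>1 / \<epsilon>\<^sup>2\<close>.\<close>
  also have "real N \<le> 256 * Q_opt \<epsilon>"
  proof -
    have "2 * N0 \<le> 256 * Q_opt \<epsilon>"
      using small_Q \<epsilon> by (simp add: N0_def Q_opt_def field_simps power2_eq_square)
    then show ?thesis using N(2) by simp
  qed
  finally have Q_upper: "?Q \<le> 512 * Q_opt \<epsilon>" by simp
  have Q: "?Q > 0" using Bpos N(3) by simp
  have \<delta>: "\<delta> > 0" using c1(1) \<delta>_opt_pos[OF \<epsilon>] by (simp add: \<delta>_def)
  have bias: "bias \<delta> = \<epsilon> / (16 * c1 * R)"
    unfolding \<delta>_def using c1(1) \<epsilon> \<beta> by (subst bias_scaled_\<delta>_opt) (simp_all add: powr_powr)
  have bias_le: "bias \<delta> \<le> \<epsilon> / R"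
    unfolding bias using c1(1) \<epsilon> R by (simp add: field_simps)
  define D where "D = R / sqrt ?Q"
  have D: "D > 0" using R Q by (simp add: D_def)
  have noise: "D * sqrt (d * \<kappa> * \<sigma>) \<le> \<epsilon> / 16"
  proof -
    have "(D * sqrt (d * \<kappa> * \<sigma>))\<^sup>2 = R\<^sup>2 * \<kappa> * d * \<sigma> / ?Q"
      using Q d \<kappa> \<sigma> by (simp add: D_def power_mult_distrib power_divide real_sqrt_pow2)
    also have "\<dots> \<le> (\<epsilon> / 16)\<^sup>2"
    proof -
      have "R\<^sup>2 * \<kappa> * d * \<sigma> = Q_opt \<epsilon> * \<epsilon>\<^sup>2" using \<epsilon> by (simp add: Q_opt_def)
      also have "\<dots> \<le> ?Q / 256 * \<epsilon>\<^sup>2" using Q_lower by (intro mult_right_mono) auto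
      finally show ?thesis using Q by (simp add: pos_divide_le_eq power_divide mult.commute)
    qed
    finally show ?thesis by (rule power2_le_imp_le) (use \<epsilon> in simp)
  qed
  have regime: "L * R\<^sup>2 / ?Q \<le> D * sqrt (d * \<kappa> * \<sigma>)"
  proof -
    define r where "r = sqrt (d * \<kappa> * \<sigma>)"
    have r: "r > 0" "r\<^sup>2 = d * \<kappa> * \<sigma>" using d \<kappa> \<sigma> by (simp_all add: r_def)
    \<comment> \<open>Dividing the claim by \<open>D\<close> leaves \<open>L D \<le> r\<close>, which holds since \<open>D\<close> is of order \<open>\<epsilon>\<close>.\<close>
    have "L * D = L * (D * r) / r" using r by simp
    also have "\<dots> \<le> L * (\<epsilon> / 16) / r"
      using noise L r unfolding r_def[symmetric] by (intro divide_right_mono mult_left_mono) auto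
    also have "\<dots> \<le> r"
      using small_regime L r by (simp add: field_simps power2_eq_square)
    finally have "D * (L * D) \<le> D * r" using D by simp
    moreover have "D * (L * D) = L * R\<^sup>2 / ?Q"
      using Q by (simp add: D_def power2_eq_square)
    ultimately show ?thesis by (simp add: r_def)
  qed
  \<comment> \<open>The radius is inverted through the increasing function \<open>\<kappa>\<^sub>\<beta> L h\<^sup>\<beta>\<^sup>-\<^sup>1 = bias \<delta>\<close>.\<close>
  have h_le: "L * h \<delta> \<le> \<sigma>"
  proof (rule ccontr)
    assume "\<not> L * h \<delta> \<le> \<sigma>"
    then have "\<sigma> / L < h \<delta>" using L by (simp add: field_simps)
    then have "(\<sigma> / L) powr (\<beta> - 1) < h \<delta> powr (\<beta> - 1)"
      using \<beta> \<sigma> L by (intro powr_less_mono2) auto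
    then have "\<kappa>b * L * (\<sigma> / L) powr (\<beta> - 1) < bias \<delta>"
      using \<kappa>b L smoothing_bias_eq[OF \<delta>] by (metis mult_pos_pos mult_strict_left_mono)
    also have "\<dots> \<le> \<kappa>b * L * (\<sigma> / L) powr (\<beta> - 1)"
      using bias_le small_h R by (smt (verit) divide_le_eq mult.commute)
    finally show False by simp
  qed
  have h_noise: "D * sqrt (d * \<kappa> * L * h \<delta>) \<le> D * sqrt (d * \<kappa> * \<sigma>)"
    using h_le D d \<kappa> by (simp add: mult.assoc)
  have bias_noise: "D * sqrt (\<kappa> * bias \<delta>) \<le> D * sqrt (d * \<kappa> * \<sigma>)"
  proof -
    have "bias \<delta> \<le> d * \<sigma>" using bias_le small_bias R by (smt (verit) divide_le_eq)
    then show ?thesis using D \<kappa> by (simp add: algebra_simps)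
  qed
  have opt_term: "L * R\<^sup>2 / (real N)\<^sup>2 \<le> \<epsilon> / 8"
  proof -
    have "L * R\<^sup>2 / (real N)\<^sup>2 \<le> L * R\<^sup>2 / (L * R\<^sup>2 / \<epsilon>)\<^sup>2"
      using N N0 LR \<epsilon> L R
      by (intro divide_left_mono power_mono mult_pos_pos zero_less_power divide_pos_pos) auto
    also have "\<dots> = \<epsilon> * \<epsilon> / (L * R\<^sup>2)"
      using LR \<epsilon> by (simp add: power_divide power2_eq_square)
    also have "\<dots> \<le> \<epsilon> / 8"
      using small_N LR \<epsilon> by (simp add: field_simps)
    finally show ?thesis .
  qed
  have bias_term: "2 * R * bias \<delta> \<le> \<epsilon> / 8"
    using c1(1) \<epsilon> R by (simp add: bias field_simps)
  have sq_term: "2 * real N * (bias \<delta>)\<^sup>2 / L \<le> \<epsilon> / 64"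
  proof -
    have "2 * real N * (bias \<delta>)\<^sup>2 / L \<le> 2 * (2 * N0) * (bias \<delta>)\<^sup>2 / L"
      using N(2) L by (intro divide_right_mono mult_right_mono mult_left_mono) auto
    also have "\<dots> = \<epsilon> / (64 * c1)"
      using c1(1) \<epsilon> L R by (simp add: N0_def bias power_divide power_mult_distrib power2_eq_square)
    also have "\<dots> \<le> \<epsilon> / 64" using c1(1) \<epsilon> by (simp add: field_simps)
    finally show ?thesis .
  qed
  have "err N B \<delta> = L * R\<^sup>2 / (real N)\<^sup>2 + L * R\<^sup>2 / ?Q + (D * sqrt (d * \<kappa> * \<sigma>)
      + D * sqrt (d * \<kappa> * L * h \<delta>) + D * sqrt (\<kappa> * bias \<delta>))
      + 2 * R * bias \<delta> + 2 * real N * (bias \<delta>)\<^sup>2 / L"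
    by (simp only: error_bound_eq[OF \<delta>] distrib_left D_def)
  then have "err N B \<delta> \<le> \<epsilon>"
    using opt_term regime noise h_noise bias_noise bias_term sq_term \<epsilon> by linarith
  moreover have "c0 * (R\<^sup>2 * A1\<^sup>2 / (A2 * \<epsilon>)) \<le> real N"
  proof -
    have "c0 * (R\<^sup>2 * A1\<^sup>2 / (A2 * \<epsilon>)) = c0 * (L * R\<^sup>2 / \<epsilon>)"
      using A1_pos L by (simp add: A2_eq)
    also have "\<dots> \<le> N0"
      unfolding N0_def using c1(2) LR \<epsilon> by (intro mult_right_mono) auto
    finally show ?thesis using N(1) by simp
  qed
  ultimately have "feasible c0 \<epsilon> N B \<delta>"
    using \<delta> N(3) Bpos regime by (simp add: feasible_design_def D_def)
  then show ?thesis using Q_upper unfolding \<delta>_def by blast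
qed

section \<open>Existence of optimal designs\<close>

lemma continuous_on_err:
  assumes "a > 0"
  shows "continuous_on {a..b} (err N B)"
proof -
  have pos: "x > 0" "h x \<noteq> 0" if "x \<in> {a..b}" for x
    using that assms h_pos[of x] by auto
  have h: "continuous_on {a..b} h"
    unfolding h_star_def using pos(1) d L \<kappa>b
    by (intro continuous_intros) force+
  show ?thesis
    unfolding error_bound_def Let_def using pos L
    by (intro continuous_intros h) auto
qed

text \<open>
  For fixed \<open>N\<close> and \<open>B\<close> the only constraint on \<open>\<delta> > 0\<close> is a closed one. The feasible \<open>\<delta>\<close> accumulate
  at 0, so compactness is applied to those above a given feasible \<open>\<delta>\<^sub>0 > 0\<close>.
\<close>

lemma largest_feasible_\<delta>:
  assumes \<epsilon>: "\<epsilon> > 0" and feas: "feasible c0 \<epsilon> N B \<delta>\<^sub>0"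
  shows "\<exists>\<delta>. feasible c0 \<epsilon> N B \<delta> \<and> (\<forall>\<delta>'. feasible c0 \<epsilon> N B \<delta>' \<longrightarrow> \<delta>' \<le> \<delta>)"
proof -
  have \<delta>0: "\<delta>\<^sub>0 > 0" using feasible_bounds(3)[OF \<epsilon> feas] .
  define S where "S = {\<delta> \<in> {\<delta>\<^sub>0..\<delta>_opt \<epsilon>}. err N B \<delta> \<le> \<epsilon>}"
  have S: "feasible c0 \<epsilon> N B \<delta> \<and> \<delta>\<^sub>0 \<le> \<delta> \<longleftrightarrow> \<delta> \<in> S" for \<delta>
    using feas \<delta>0 feasible_bounds(5)[OF \<epsilon>, of c0 N B \<delta>]
    by (auto simp: S_def feasible_design_def)
  have "closed S"
  proof -
    have "S = err N B -` {..\<epsilon>} \<inter> {\<delta>\<^sub>0..\<delta>_opt \<epsilon>}" by (auto simp: S_def)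
    then show ?thesis
      using continuous_on_err[OF \<delta>0, of "\<delta>_opt \<epsilon>" N B]
      by (simp add: continuous_on_closed_vimage[OF closed_real_atLeastAtMost])
  qed
  then have "compact ({\<delta>\<^sub>0..\<delta>_opt \<epsilon>} \<inter> S)"
    by (intro compact_Int_closed compact_Icc)
  moreover have "{\<delta>\<^sub>0..\<delta>_opt \<epsilon>} \<inter> S = S" by (auto simp: S_def)
  moreover have "S \<noteq> {}" using S[of "\<delta>\<^sub>0"] feas by auto
  ultimately obtain \<delta> where \<delta>: "\<delta> \<in> S" "\<And>\<delta>'. \<delta>' \<in> S \<Longrightarrow> \<delta>' \<le> \<delta>"
    using compact_attains_sup[of S] by auto
  have "\<delta>' \<le> \<delta>" if "feasible c0 \<epsilon> N B \<delta>'" for \<delta>'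
    using that \<delta> S[of \<delta>] S[of \<delta>'] by fastforce
  then show ?thesis using \<delta>(1) S[of \<delta>] by blast
qed

text \<open>
  The cost decreases in \<open>\<delta>\<close>, so for each pair \<open>(N, B)\<close> the largest feasible \<open>\<delta>\<close> is best. Since
  \<open>\<delta>\<close> is bounded above, a cost of at most \<open>T\<^sub>0\<close> bounds \<open>B N\<close>, which leaves finitely many pairs.
\<close>

lemma optimal_design_exists:
  assumes \<gamma>: "\<gamma> > 0" and \<epsilon>: "\<epsilon> > 0" and feas: "feasible c0 \<epsilon> N\<^sub>0 B\<^sub>0 \<delta>\<^sub>0"
  shows "\<exists>N B \<delta>. optimal \<gamma> c0 \<epsilon> N B \<delta>"
proof -
  define T0 where "T0 = T_total \<gamma> N\<^sub>0 B\<^sub>0 \<delta>\<^sub>0"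
  define M where "M = nat \<lceil>T0 * \<delta>_opt \<epsilon> powr \<gamma>\<rceil>"
  define best where "best N B = (SOME \<delta>. feasible c0 \<epsilon> N B \<delta> \<and>
      (\<forall>\<delta>'. feasible c0 \<epsilon> N B \<delta>' \<longrightarrow> \<delta>' \<le> \<delta>))" for N B
  have best: "feasible c0 \<epsilon> N B (best N B)" "\<delta> \<le> best N B" if "feasible c0 \<epsilon> N B \<delta>" for N B \<delta>
    using someI_ex[OF largest_feasible_\<delta>[OF \<epsilon> that]] that by (auto simp: best_def)
  define P where "P = {(N, B). N \<le> M \<and> B \<le> M \<and> (\<exists>\<delta>. feasible c0 \<epsilon> N B \<delta>)}"
  define T where "T = (\<lambda>(N, B). T_total \<gamma> N B (best N B))"
  have fin: "finite P"
    by (rule finite_subset[of _ "{..M} \<times> {..M}"]) (auto simp: P_def)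
  have T_le: "T (N, B) \<le> T_total \<gamma> N B \<delta>" if "feasible c0 \<epsilon> N B \<delta>" for N B \<delta>
    using best[OF that] feasible_bounds(3)[OF \<epsilon> that] \<gamma>
    by (auto simp: T_def T_total_def intro!: mult_left_mono powr_mono2')
  have in_P: "(N, B) \<in> P" if f: "feasible c0 \<epsilon> N B \<delta>" and T: "T_total \<gamma> N B \<delta> \<le> T0" for N B \<delta>
  proof -
    note b = feasible_bounds[OF \<epsilon> f]
    have "real B * real N = T_total \<gamma> N B \<delta> * \<delta> powr \<gamma>"
      using b(3) by (simp add: T_total_def powr_minus)
    also have "\<dots> \<le> T0 * \<delta>_opt \<epsilon> powr \<gamma>"
      using b T \<gamma> by (intro mult_mono powr_mono2) (auto simp: T_total_def intro: order_trans[OF _ T])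
    also have "\<dots> \<le> real M" unfolding M_def by (rule real_nat_ceiling_ge)
    finally have "B * N \<le> M" by (metis of_nat_le_iff of_nat_mult)
    moreover have "B \<le> B * N" "N \<le> B * N" using b(1,2) by simp_all
    ultimately have "N \<le> M" "B \<le> M" by linarith+
    then show ?thesis using f by (auto simp: P_def)
  qed
  have start: "(N\<^sub>0, B\<^sub>0) \<in> P" by (rule in_P[OF feas]) (simp add: T0_def)
  then obtain N B where NB: "(N, B) \<in> P" and min: "\<And>x. x \<in> P \<Longrightarrow> T (N, B) \<le> T x"
    using arg_min_if_finite[OF fin, of T] by (metis empty_iff linorder_not_le surj_pair)
  have "T_total \<gamma> N B (best N B) \<le> T_total \<gamma> N' B' \<delta>'" if f: "feasible c0 \<epsilon> N' B' \<delta>'" for N' B' \<delta>'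
  proof (cases "T_total \<gamma> N' B' \<delta>' \<le> T0")
    case True
    then show ?thesis
      using min[OF in_P[OF f]] T_le[OF f] by (simp add: T_def)
  next
    case False
    then show ?thesis
      using min[OF start] T_le[OF feas] by (simp add: T_def T0_def)
  qed
  moreover have "feasible c0 \<epsilon> N B (best N B)" using NB best(1) by (auto simp: P_def)
  ultimately show ?thesis unfolding optimal_design_def by blast
qed

section \<open>Orders of near-optimal designs\<close>

lemma T_opt_eq:
  assumes "\<epsilon> > 0"
  shows "Q_opt \<epsilon> * \<delta>_opt \<epsilon> powr (- \<gamma>) =
    \<kappa> * \<sigma> * d powr (1 + \<gamma>) * \<kappa>b powr (\<gamma> / (\<beta> - 1)) * L powr (\<gamma> / (\<beta> - 1))
      * R powr (2 + \<gamma> * \<beta> / (\<beta> - 1)) / \<epsilon> powr (2 + \<gamma> * \<beta> / (\<beta> - 1))"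
proof -
  have e: "\<beta> / (\<beta> - 1) * \<gamma> = \<gamma> * \<beta> / (\<beta> - 1)" "1 / (\<beta> - 1) * \<gamma> = \<gamma> / (\<beta> - 1)"
    by simp_all
  have "\<delta>_opt \<epsilon> powr \<gamma> = \<epsilon> powr (\<gamma> * \<beta> / (\<beta> - 1)) / (d powr \<gamma> * \<kappa>b powr (\<gamma> / (\<beta> - 1))
      * L powr (\<gamma> / (\<beta> - 1)) * R powr (\<gamma> * \<beta> / (\<beta> - 1)))"
    unfolding \<delta>_opt_def using assms d L R \<kappa>b
    by (simp add: powr_divide powr_mult powr_powr e del: times_divide_eq_left times_divide_eq_right)
  then show ?thesis
    using assms d R by (simp add: Q_opt_def powr_minus powr_add divide_inverse)
qed

text \<open>
  Near-optimality of the product \<open>Q \<delta>\<^bsup>-\<gamma>\<^esup>\<close> forces both factors to be near their bounds: each has its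
  own lower bound, so neither can compensate for an excess of the other. The
  resulting lower bound on \<open>\<delta>\<close>, hence on the bias, turns \<open>2 N (bias \<delta>)\<^sup>2 / L \<le> \<epsilon>\<close> into an upper
  bound on \<open>N\<close>, and the order of \<open>B\<close> is that of \<open>Q / N\<close>.
\<close>

lemma near_optimal_design_orders:
  assumes \<gamma>: "\<gamma> > 0" and c0: "c0 > 0" and \<epsilon>: "\<epsilon> > 0" and K: "K > 0"
    and feas: "feasible c0 \<epsilon> N B \<delta>"
    and T: "T_total \<gamma> N B \<delta> \<le> K * (Q_opt \<epsilon> * \<delta>_opt \<epsilon> powr (- \<gamma>))"
  defines "k \<equiv> K powr (- 1 / \<gamma>)"
  shows "same_order c0 (1 / (2 * k powr (2 * p))) (real N) (L * R\<^sup>2 / \<epsilon>)"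
    and "same_order 1 K (real B * real N) (Q_opt \<epsilon>)"
    and "same_order (2 * k powr (2 * p)) (K / c0) (real B) (\<kappa> * d * \<sigma> / (L * \<epsilon>))"
    and "same_order k 1 \<delta> (\<delta>_opt \<epsilon>)"
    and "same_order 1 K (T_total \<gamma> N B \<delta>) (Q_opt \<epsilon> * \<delta>_opt \<epsilon> powr (- \<gamma>))"
proof -
  note b = feasible_bounds[OF \<epsilon> feas]
  let ?Q = "real B * real N"
  let ?\<delta>0 = "\<delta>_opt \<epsilon>"
  have \<delta>0: "?\<delta>0 > 0" and Q0: "Q_opt \<epsilon> > 0" using \<delta>_opt_pos Q_opt_pos \<epsilon> by simp_all
  have k: "k > 0" using K by (simp add: k_def)
  have powr_le: "?\<delta>0 powr (- \<gamma>) \<le> \<delta> powr (- \<gamma>)"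
    using b(3,5) \<gamma> by (intro powr_mono2') auto
  have "Q_opt \<epsilon> * ?\<delta>0 powr (- \<gamma>) \<le> T_total \<gamma> N B \<delta>"
    unfolding T_total_def using b(4) powr_le Q0 by (intro mult_mono) auto
  then show "same_order 1 K (T_total \<gamma> N B \<delta>) (Q_opt \<epsilon> * ?\<delta>0 powr (- \<gamma>))"
    using T by (simp add: same_order_def)
  have "?Q * ?\<delta>0 powr (- \<gamma>) \<le> T_total \<gamma> N B \<delta>"
    unfolding T_total_def using powr_le by (intro mult_left_mono) auto
  also note T
  finally have Q_upper: "?Q \<le> K * Q_opt \<epsilon>" using \<delta>0 by (simp add: mult.assoc[symmetric])
  then show "same_order 1 K ?Q (Q_opt \<epsilon>)" using b(4) by (simp add: same_order_def)
  have "Q_opt \<epsilon> * \<delta> powr (- \<gamma>) \<le> T_total \<gamma> N B \<delta>"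
    unfolding T_total_def using b(4) by (intro mult_right_mono) auto
  also note T
  also have "K * (Q_opt \<epsilon> * ?\<delta>0 powr (- \<gamma>)) = Q_opt \<epsilon> * (k * ?\<delta>0) powr (- \<gamma>)"
    using K \<delta>0 \<gamma> by (simp add: k_def powr_mult powr_powr)
  finally have "\<delta> powr (- \<gamma>) \<le> (k * ?\<delta>0) powr (- \<gamma>)" using Q0 by simp
  then have \<delta>_lower: "k * ?\<delta>0 \<le> \<delta>"
    using powr_less_mono2_neg[of "- \<gamma>" \<delta> "k * ?\<delta>0"] b(3) \<gamma> by linarith
  then show "same_order k 1 \<delta> ?\<delta>0" using b(5) by (simp add: same_order_def)
  have "k powr p * \<epsilon> / R \<le> bias \<delta>"
    using \<delta>_lower k \<delta>0 b(3) bias_le_iff[of "k * ?\<delta>0" \<delta>] bias_scaled_\<delta>_opt[OF \<epsilon> k] by simp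
  then have "2 * real N * (k powr p * \<epsilon> / R)\<^sup>2 / L \<le> 2 * real N * (bias \<delta>)\<^sup>2 / L"
    using L R \<epsilon> by (intro divide_right_mono mult_left_mono power_mono) auto
  also note b(6)
  also have "(k powr p * \<epsilon> / R)\<^sup>2 = k powr (2 * p) * \<epsilon>\<^sup>2 / R\<^sup>2"
    by (simp add: power_mult_distrib power_divide power2_eq_square powr_add[symmetric])
  finally have "2 * real N * (k powr (2 * p) * \<epsilon>\<^sup>2 / R\<^sup>2) / L \<le> \<epsilon>" .
  then have N_upper: "real N * (2 * k powr (2 * p)) \<le> L * R\<^sup>2 / \<epsilon>"
    using L R \<epsilon> by (simp add: field_simps power2_eq_square)
  have "real N \<le> L * R\<^sup>2 / \<epsilon> / (2 * k powr (2 * p))"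
    using N_upper k by (subst pos_le_divide_eq) simp_all
  then show "same_order c0 (1 / (2 * k powr (2 * p))) (real N) (L * R\<^sup>2 / \<epsilon>)"
    using b(7) unfolding same_order_def
    by (simp only: mult_1 times_divide_eq_left simp_thms)
  have ratio: "Q_opt \<epsilon> = \<kappa> * d * \<sigma> / (L * \<epsilon>) * (L * R\<^sup>2 / \<epsilon>)"
    using L \<epsilon> by (simp add: Q_opt_def power2_eq_square)
  have B0: "\<kappa> * d * \<sigma> / (L * \<epsilon>) > 0" and N0: "L * R\<^sup>2 / \<epsilon> > 0"
    using \<kappa> d \<sigma> L \<epsilon> R by simp_all
  show "same_order (2 * k powr (2 * p)) (K / c0) (real B) (\<kappa> * d * \<sigma> / (L * \<epsilon>))"
    unfolding same_order_def
  proof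
    have "2 * k powr (2 * p) * (\<kappa> * d * \<sigma> / (L * \<epsilon>)) * real N
        = \<kappa> * d * \<sigma> / (L * \<epsilon>) * (real N * (2 * k powr (2 * p)))" by simp
    also have "\<dots> \<le> \<kappa> * d * \<sigma> / (L * \<epsilon>) * (L * R\<^sup>2 / \<epsilon>)"
      using N_upper B0 by (intro mult_left_mono) auto
    also have "\<dots> \<le> real B * real N" using b(4) by (simp only: ratio)
    finally show "2 * k powr (2 * p) * (\<kappa> * d * \<sigma> / (L * \<epsilon>)) \<le> real B"
      by (rule mult_right_le_imp_le) (use b(1) in simp)
  next
    have "real B * (c0 * (L * R\<^sup>2 / \<epsilon>)) \<le> ?Q"
      using b(7) by (intro mult_left_mono) auto
    also have "\<dots> \<le> K * (\<kappa> * d * \<sigma> / (L * \<epsilon>)) * (L * R\<^sup>2 / \<epsilon>)"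
      using Q_upper by (simp only: ratio mult.assoc)
    finally have "real B * c0 * (L * R\<^sup>2 / \<epsilon>) \<le> K * (\<kappa> * d * \<sigma> / (L * \<epsilon>)) * (L * R\<^sup>2 / \<epsilon>)"
      by (simp only: mult.assoc)
    then have "real B * c0 \<le> K * (\<kappa> * d * \<sigma> / (L * \<epsilon>))"
      using N0 by (rule mult_right_le_imp_le)
    then have "real B \<le> K * (\<kappa> * d * \<sigma> / (L * \<epsilon>)) / c0"
      using c0 by (subst pos_le_divide_eq)
    then show "real B \<le> K / c0 * (\<kappa> * d * \<sigma> / (L * \<epsilon>))"
      by (simp only: times_divide_eq_left)
  qed
qed

text \<open>
  The constant \<open>K\<close> bounds the cost of the explicit feasible design relative to \<open>Q\<^sup>* (\<delta>\<^sup>*)\<^bsup>-\<gamma>\<^esup>\<close>; it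
  involves only \<open>\<beta>\<close>, \<open>\<gamma>\<close> and \<open>c1\<close>, which is what makes the orders uniform in the other
  parameters.
\<close>

lemma eventually_optimal_cost_le:
  assumes \<gamma>: "\<gamma> > 0" and c0: "c0 > 0" and c1: "c1 \<ge> 1" "c0 \<le> c1"
  defines "K \<equiv> 512 * ((1 / (16 * c1)) powr (1 / p)) powr (- \<gamma>)"
  shows "\<forall>\<^sub>F \<epsilon> in at_right 0. \<epsilon> > 0 \<and> (\<exists>N B \<delta>. optimal \<gamma> c0 \<epsilon> N B \<delta>) \<and>
    (\<forall>N B \<delta>. optimal \<gamma> c0 \<epsilon> N B \<delta> \<longrightarrow> feasible c0 \<epsilon> N B \<delta> \<and>
       T_total \<gamma> N B \<delta> \<le> K * (Q_opt \<epsilon> * \<delta>_opt \<epsilon> powr (- \<gamma>)))"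
proof -
  have small: "\<forall>\<^sub>F \<epsilon> in at_right 0. \<epsilon> \<le> a" if "a > 0" for a :: real
    using that by (auto simp: eventually_at_right_field intro: exI[of _ a])
  have pos: "L * R\<^sup>2 / 8 > 0" "256 * (R\<^sup>2 * \<kappa> * d * \<sigma>) / (2 * c1 * (L * R\<^sup>2)) > 0"
      "16 * (d * \<kappa> * \<sigma>) / L > 0" "d * \<sigma> * R > 0"
      "R * (\<kappa>b * L * (\<sigma> / L) powr (\<beta> - 1)) > 0"
    using L R \<kappa> d \<sigma> \<kappa>b c1(1) by simp_all
  show ?thesis
    using small[OF pos(1)] small[OF pos(2)] small[OF pos(3)] small[OF pos(4)] small[OF pos(5)]
      eventually_at_right_less[of "0::real"]
  proof eventually_elim
    case (elim \<epsilon>)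
    have "2 * c1 * (L * R\<^sup>2) * \<epsilon> \<le> 256 * (R\<^sup>2 * \<kappa> * d * \<sigma>)"
      using elim(2) c1(1) L R by (simp add: field_simps)
    with elim obtain N\<^sub>0 B\<^sub>0 where
      feas: "feasible c0 \<epsilon> N\<^sub>0 B\<^sub>0 ((1 / (16 * c1)) powr (1 / p) * \<delta>_opt \<epsilon>)" (is "feasible _ _ _ _ ?\<delta>")
      and Q: "real B\<^sub>0 * real N\<^sub>0 \<le> 512 * Q_opt \<epsilon>"
      using feasible_design_exists[OF c1, of \<epsilon>] by blast
    have "T_total \<gamma> N\<^sub>0 B\<^sub>0 ?\<delta> \<le> 512 * Q_opt \<epsilon> * ?\<delta> powr (- \<gamma>)"
      unfolding T_total_def using Q by (intro mult_right_mono) auto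
    also have "\<dots> = K * (Q_opt \<epsilon> * \<delta>_opt \<epsilon> powr (- \<gamma>))"
      using \<delta>_opt_pos[OF elim(6)] c1(1) by (simp add: K_def powr_mult)
    finally have "T_total \<gamma> N B \<delta> \<le> K * (Q_opt \<epsilon> * \<delta>_opt \<epsilon> powr (- \<gamma>))"
      if "optimal \<gamma> c0 \<epsilon> N B \<delta>" for N B \<delta>
      using that feas unfolding optimal_design_def by (meson order_trans)
    then show ?case
      using optimal_design_exists[OF \<gamma> elim(6) feas] elim(6) by (auto simp: optimal_design_def)
  qed
qed

end

lemma same_order_weaken:
  assumes "same_order c' C' x y" "c \<le> c'" "C' \<le> C" "y \<ge> 0"
  shows "same_order c C x y"
  using assms unfolding same_order_def by (meson mult_right_mono order_trans)

theorem proposition6: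
  fixes \<beta> \<gamma> c0 :: real
  assumes "\<beta> \<ge> 2" and "\<gamma> > 0" and "c0 > 0"
  shows "\<exists>c>0. \<exists>C>0. \<forall>d>0. \<forall>L>0. \<forall>R>0. \<forall>\<kappa>>0. \<forall>\<kappa>b>0. \<forall>\<sigma>>0.
    (\<forall>(N::nat) \<delta>. N > 0 \<longrightarrow> \<delta> > 0 \<longrightarrow>
       (let p = (\<beta> - 1) / \<beta>; h = h_star \<beta> d L \<kappa>b \<delta> in
          same_order c C (R * (\<kappa>b * L * h powr (\<beta> - 1) + d * \<delta> / h))
            (R * a1 \<beta> d L \<kappa>b * \<delta> powr p) \<and>
          same_order c C
            (real N * (\<kappa>b\<^sup>2 * L * h powr (2 * (\<beta> - 1)) + d\<^sup>2 * \<delta>\<^sup>2 / (L * h\<^sup>2)))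
            (real N * a2 \<beta> d L \<kappa>b * \<delta> powr (2 * p)))) \<and>
    (\<forall>\<^sub>F \<epsilon> in at_right 0.
       (\<exists>N B \<delta>. optimal_design \<beta> \<gamma> d L R \<kappa> \<kappa>b \<sigma> c0 \<epsilon> N B \<delta>) \<and>
       (\<forall>N B \<delta>. optimal_design \<beta> \<gamma> d L R \<kappa> \<kappa>b \<sigma> c0 \<epsilon> N B \<delta> \<longrightarrow>
          same_order c C (real N) (L * R\<^sup>2 / \<epsilon>) \<and>
          same_order c C (real B * real N) (R\<^sup>2 * \<kappa> * d * \<sigma> / \<epsilon>\<^sup>2) \<and>
          same_order c C (real B) (\<kappa> * d * \<sigma> / (L * \<epsilon>)) \<and>
          same_order c C \<delta>
            (\<epsilon> powr (\<beta> / (\<beta> - 1)) /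
             (d * \<kappa>b powr (1 / (\<beta> - 1)) * L powr (1 / (\<beta> - 1)) * R powr (\<beta> / (\<beta> - 1)))) \<and>
          same_order c C (T_total \<gamma> N B \<delta>)
            (\<kappa> * \<sigma> * d powr (1 + \<gamma>) * \<kappa>b powr (\<gamma> / (\<beta> - 1)) * L powr (\<gamma> / (\<beta> - 1))
               * R powr (2 + \<gamma> * \<beta> / (\<beta> - 1))
             / \<epsilon> powr (2 + \<gamma> * \<beta> / (\<beta> - 1)))))"
proof -
  define p where "p = (\<beta> - 1) / \<beta>"
  \<comment> \<open>All constants are fixed before the parameters \<open>d, L, R, \<kappa>, \<kappa>\<^sub>\<beta>, \<sigma>\<^sub>*\<close> enter; \<open>c\<close> and \<open>C\<close> collect
      the extreme constants of the individual relations.\<close>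
  define c1 where "c1 = max 1 c0"
  define K where "K = 512 * ((1 / (16 * c1)) powr (1 / p)) powr (- \<gamma>)"
  define k where "k = K powr (- 1 / \<gamma>)"
  define c where "c = min (min 1 c0) (min k (2 * k powr (2 * p)))"
  define C where "C = 2 + K + K / c0 + 1 / (2 * k powr (2 * p))"
  have c1: "c1 \<ge> 1" "c0 \<le> c1" by (simp_all add: c1_def)
  have K: "K > 0" and k: "k > 0" using c1(1) by (simp_all add: K_def k_def)
  have c_le: "c \<le> 1" "c \<le> c0" "c \<le> k" "c \<le> 2 * k powr (2 * p)"
    unfolding c_def by linarith+
  have "K / c0 > 0" "1 / (2 * k powr (2 * p)) > 0" using K k \<open>c0 > 0\<close> by simp_all
  then have le_C: "1 \<le> C" "2 \<le> C" "K \<le> C" "K / c0 \<le> C" "1 / (2 * k powr (2 * p)) \<le> C"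
    using K unfolding C_def by linarith+
  have c: "c > 0" using k \<open>c0 > 0\<close> by (simp add: c_def)
  have C: "C > 0" using le_C by linarith
  show ?thesis
  proof (rule exI[of _ c], intro conjI[OF c], rule exI[of _ C], intro conjI[OF C] allI impI, goal_cases)
    case (1 d L R \<kappa> \<kappa>b \<sigma>)
    then interpret zeroth_order_sgd \<beta> d L R \<kappa> \<kappa>b \<sigma>
      using \<open>\<beta> \<ge> 2\<close> by unfold_locales
    show ?case
    proof (intro conjI allI impI, goal_cases)
      case (1 N \<delta>)
      note \<delta> = \<open>\<delta> > 0\<close>
      have "A2 * \<delta> powr (2 * p) = (bias \<delta>)\<^sup>2 / L"
        using \<delta> by (simp add: bias_eq A2_eq p_def power_mult_distrib power2_eq_square powr_add[symmetric])
      then have A2': "real N * A2 * \<delta> powr (2 * p) = real N * (bias \<delta>)\<^sup>2 / L"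
        by (simp add: mult.assoc)
      have A1': "R * A1 * \<delta> powr p = R * bias \<delta>"
        using bias_eq[OF \<delta>] by (simp add: p_def)
      have eq: "same_order c C (2 * x) x" if "x \<ge> 0" for x
        using that c_le(1) le_C(2) by (simp add: same_order_def mult_right_mono)
      show ?case
        unfolding Let_def p_def[symmetric] bias_terms_eq[OF \<delta>] squared_bias_terms_eq[OF \<delta>] A1' A2'
        using eq[of "R * bias \<delta>"] eq[of "real N * (bias \<delta>)\<^sup>2 / L"] R L bias_pos[OF \<delta>]
        by (simp add: mult.assoc)
    next
      case 2
      show ?case
        using eventually_optimal_cost_le[OF \<open>\<gamma> > 0\<close> \<open>c0 > 0\<close> c1]
        unfolding p_def[symmetric] K_def[symmetric]
      proof eventually_elim
        case (elim \<epsilon>)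
        then have \<epsilon>: "\<epsilon> > 0" by blast
        have y: "L * R\<^sup>2 / \<epsilon> \<ge> 0" "Q_opt \<epsilon> \<ge> 0" "\<kappa> * d * \<sigma> / (L * \<epsilon>) \<ge> 0" "\<delta>_opt \<epsilon> \<ge> 0"
            "Q_opt \<epsilon> * \<delta>_opt \<epsilon> powr (- \<gamma>) \<ge> 0"
          using L R \<kappa> d \<sigma> \<epsilon> Q_opt_pos[OF \<epsilon>] \<delta>_opt_pos[OF \<epsilon>] by simp_all
        have "same_order c C (real N) (L * R\<^sup>2 / \<epsilon>)
            \<and> same_order c C (real B * real N) (Q_opt \<epsilon>)
            \<and> same_order c C (real B) (\<kappa> * d * \<sigma> / (L * \<epsilon>))
            \<and> same_order c C \<delta> (\<delta>_opt \<epsilon>)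
            \<and> same_order c C (T_total \<gamma> N B \<delta>) (Q_opt \<epsilon> * \<delta>_opt \<epsilon> powr (- \<gamma>))"
          if "optimal \<gamma> c0 \<epsilon> N B \<delta>" for N B \<delta>
        proof -
          have "feasible c0 \<epsilon> N B \<delta>" "T_total \<gamma> N B \<delta> \<le> K * (Q_opt \<epsilon> * \<delta>_opt \<epsilon> powr (- \<gamma>))"
            using elim that by blast+
          note orders = near_optimal_design_orders[OF \<open>\<gamma> > 0\<close> \<open>c0 > 0\<close> \<epsilon> K this,
              folded k_def p_def]
          show ?thesis
            by (intro conjI orders[THEN same_order_weaken] c_le le_C y)
        qed
        then show ?case
          using elim unfolding T_opt_eq[OF \<epsilon>] unfolding Q_opt_def \<delta>_opt_def by blast
      qed
    qed
  qed
qed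

end
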